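(* Let $k$ be even and let $G$ be a $k$-uniform minimal non-odd-bipartite hypergraph with $n$ vertices and $m$ edges. Then (1) $\lambda_{\min}(G) \le -\rho(G)+\dfrac{2k}{n^{1/k}}$; (2) $\lambda_{\min}(G) \le -\left(1- \dfrac{2}{m}\right)\rho(G)$.
   Context: A hypergraph has a finite vertex set and an edge set of distinct nonempty subsets, with no isolated vertices; it is $k$-uniform if all edges have $k$ vertices. For $k$ even, a $k$-uniform hypergraph $G$ is odd-bipartite if there is a bipartition $\{U,U^c\}$ of $V(G)$ such that every edge meets $U$ (and hence $U^c$) in an odd number of vertices; it is minimal non-odd-bipartite if it is not odd-bipartite but $G-e$ (delete the edge $e$ from the edge set) is odd-bipartite for every edge $e$. For a $k$-uniform $G$ on vertices $v_1,\dots,v_n$, the adjacency tensor $\mathcal{A}(G)=(a_{i_1\dots i_k})$ is the order-$k$, dimension-$n$ tensor with $a_{i_1\dots i_k}=\frac{1}{(k-1)!}$ if $\{v_{i_1},\dots,v_{i_k}\}\in E(G)$ and $0$ otherwise. For $x\in\mathbb{C}^n$, $(\mathcal{A}x^{k-1})_i=\sum_{i_2,\dots,i_k}a_{ii_2\dots i_k}x_{i_2}\cdots x_{i_k}$; $\lambda\in\mathbb{C}$ is an eigenvalue if $\mathcal{A}x^{k-1}=\lambda x^{[k-1]}$ for some nonzero $x\in\mathbb{C}^n$, where $x^{[k-1]}=(x_1^{k-1},\dots,x_n^{k-1})$; it is an H-eigenvalue if moreover $x$ can be taken real. $\rho(G)$ is the maximum modulus of the eigenvalues of $\mathcal{A}(G)$,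 and $\lambda_{\min}(G)$ is the least H-eigenvalue of $\mathcal{A}(G)$. *)

theory Defs
  imports Complex_Main
begin

definition hypergraph :: "'a set \<Rightarrow> 'a set set \<Rightarrow> bool" where
  "hypergraph V E \<longleftrightarrow>
     finite V \<and> (\<forall>e\<in>E. e \<subseteq> V \<and> e \<noteq> {}) \<and> (\<forall>v\<in>V. \<exists>e\<in>E. v \<in> e)"

definition uniform_hypergraph :: "nat \<Rightarrow> 'a set set \<Rightarrow> bool" where
  "uniform_hypergraph k E \<longleftrightarrow> (\<forall>e\<in>E. card e = k)"

text \<open>The bipartition is \<open>{U, V - U}\<close>. For uniform edges of even size, both parts are
  automatically nonempty as soon as there is an edge. The definition does not demand the
  absence of isolated vertices, because deleting an edge may create some.\<close>

definition odd_bipartite :: "'a set \<Rightarrow> 'a set set \<Rightarrow> bool" where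
  "odd_bipartite V E \<longleftrightarrow> (\<exists>U\<subseteq>V. \<forall>e\<in>E. odd (card (e \<inter> U)))"

definition minimal_non_odd_bipartite :: "'a set \<Rightarrow> 'a set set \<Rightarrow> bool" where
  "minimal_non_odd_bipartite V E \<longleftrightarrow>
     \<not> odd_bipartite V E \<and> (\<forall>e\<in>E. odd_bipartite V (E - {e}))"

text \<open>A tensor of order \<open>k\<close> whose indices range over a finite set \<open>V\<close> is a function on
  lists; only its values on lists of length \<open>k\<close> over \<open>V\<close> matter. Likewise a vector
  indexed by \<open>V\<close> is a function of which only the values on \<open>V\<close> matter.\<close>

definition tensor_apply ::
  "nat \<Rightarrow> 'a set \<Rightarrow> ('a list \<Rightarrow> complex) \<Rightarrow> ('a \<Rightarrow> complex) \<Rightarrow> 'a \<Rightarrow> complex" where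
  "tensor_apply k V A x i =
     (\<Sum>is | length is = k - 1 \<and> set is \<subseteq> V. A (i # is) * prod_list (map x is))"

definition eigenpair ::
  "nat \<Rightarrow> 'a set \<Rightarrow> ('a list \<Rightarrow> complex) \<Rightarrow> complex \<Rightarrow> ('a \<Rightarrow> complex) \<Rightarrow> bool" where
  "eigenpair k V A \<mu> x \<longleftrightarrow>
     (\<exists>i\<in>V. x i \<noteq> 0) \<and> (\<forall>i\<in>V. tensor_apply k V A x i = \<mu> * x i ^ (k - 1))"

definition eigenvalue :: "nat \<Rightarrow> 'a set \<Rightarrow> ('a list \<Rightarrow> complex) \<Rightarrow> complex \<Rightarrow> bool" where
  "eigenvalue k V A \<mu> \<longleftrightarrow> (\<exists>x. eigenpair k V A \<mu> x)"

definition H_eigenvalue :: "nat \<Rightarrow> 'a set \<Rightarrow> ('a list \<Rightarrow> complex) \<Rightarrow> complex \<Rightarrow> bool" where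
  "H_eigenvalue k V A \<mu> \<longleftrightarrow> (\<exists>x. eigenpair k V A \<mu> x \<and> (\<forall>i\<in>V. x i \<in> \<real>))"

definition adjacency_tensor :: "nat \<Rightarrow> 'a set set \<Rightarrow> 'a list \<Rightarrow> complex" where
  "adjacency_tensor k E is = (if set is \<in> E then 1 / fact (k - 1) else 0)"

definition spectral_radius :: "nat \<Rightarrow> 'a set \<Rightarrow> 'a set set \<Rightarrow> real" where
  "spectral_radius k V E =
     (GREATEST r. \<exists>\<mu>. eigenvalue k V (adjacency_tensor k E) \<mu> \<and> r = cmod \<mu>)"

text \<open>H-eigenvalues of a real tensor are real numbers, so the least one is sought in
  \<^typ>\<open>real\<close>.\<close>

definition lambda_min :: "nat \<Rightarrow> 'a set \<Rightarrow> 'a set set \<Rightarrow> real" where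
  "lambda_min k V E =
     (LEAST r. H_eigenvalue k V (adjacency_tensor k E) (complex_of_real r))"

end

theory Submission
  imports Defs "HOL-Analysis.Analysis" "HOL-Combinatorics.Multiset_Permutations"
begin

text \<open>For even \<open>k\<close>, write \<open>W(x) = \<Sum>e\<in>E. \<Prod>v\<in>e. x v\<close> and \<open>P(x) = \<Sum>v\<in>V. x v ^ k\<close> for real
  vectors \<open>x\<close>. By Lagrange multipliers the least H-eigenvalue is the minimum of \<open>k W\<close> on the
  compact sphere \<open>P = 1\<close>; likewise the spectral radius is the maximum, attained at some
  nonnegative \<open>x\<close>. Deleting an edge \<open>e\<close> makes the hypergraph odd-bipartite, with a part \<open>U\<close>
  say. Switching the signs of \<open>x\<close> on \<open>U\<close> negates the contribution of every edge other than
  \<open>e\<close>, hence \<open>\<lambda>\<^sub>m\<^sub>i\<^sub>n \<le> -\<rho> + 2 k (\<Prod>v\<in>e. x v)\<close>. For the first bound take \<open>e\<close> through a vertex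
  with the least entry of \<open>x\<close>, which is at most \<open>n\<^bsup>-1/k\<^esup>\<close>; for the second take \<open>e\<close> with the
  least product, which is at most the average \<open>\<rho> / (k m)\<close>.\<close>

section \<open>The edge polynomial, its gradient and the power sum\<close>

definition edge_form :: "'a set set \<Rightarrow> ('a \<Rightarrow> 'b::comm_semiring_1) \<Rightarrow> 'b" where
  "edge_form E x = (\<Sum>e\<in>E. \<Prod>v\<in>e. x v)"

text \<open>The partial derivative of \<open>edge_form E\<close> in the coordinate \<open>i\<close>.
  Scalars are polymorphic because eigenvectors are complex, whereas the extremal problem is
  real.\<close>

definition edge_deriv :: "'a set set \<Rightarrow> ('a \<Rightarrow> 'b::comm_semiring_1) \<Rightarrow> 'a \<Rightarrow> 'b" where
  "edge_deriv E x i = (\<Sum>e | e \<in> E \<and> i \<in> e. \<Prod>v\<in>e - {i}. x v)"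

definition power_form :: "nat \<Rightarrow> 'a set \<Rightarrow> ('a \<Rightarrow> 'b::comm_semiring_1) \<Rightarrow> 'b" where
  "power_form k V x = (\<Sum>v\<in>V. x v ^ k)"

locale even_uniform_hypergraph =
  fixes k :: nat and V :: "'a set" and E :: "'a set set"
  assumes even_k: "even k"
    and k_pos: "0 < k"
    and finite_V: "finite V"
    and edge_subset: "\<And>e. e \<in> E \<Longrightarrow> e \<subseteq> V"
    and card_edge: "\<And>e. e \<in> E \<Longrightarrow> card e = k"
    and V_nonempty: "V \<noteq> {}"
begin

lemma finite_E: "finite E"
  by (rule finite_subset[of _ "Pow V"]) (use edge_subset finite_V in auto)

lemma finite_edge: "e \<in> E \<Longrightarrow> finite e"
  using edge_subset finite_V finite_subset by blast

lemma power_k: "a ^ k = a * a ^ (k - 1)" for a :: "'b::monoid_mult"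
  using k_pos by (cases k) auto

lemma edge_deriv_cong:
  assumes "\<And>v. v \<in> V \<Longrightarrow> x v = y v"
  shows "edge_deriv E x i = edge_deriv E y i"
  unfolding edge_deriv_def
  by (intro sum.cong refl prod.cong) (use assms edge_subset in blast)+

lemma edge_form_cong:
  assumes "\<And>v. v \<in> V \<Longrightarrow> x v = y v"
  shows "edge_form E x = edge_form E y"
  unfolding edge_form_def
  by (intro sum.cong refl prod.cong) (use assms edge_subset in blast)+

text \<open>A list of length \<open>k\<close> whose set is an edge enumerates that edge without repetition; the
  edges through \<open>i\<close> thus arise from \<open>(k - 1)!\<close> index lists each, which cancels the factor in
  the tensor.\<close>

lemma tensor_apply_adjacency:
  "tensor_apply k V (adjacency_tensor k E) x i = edge_deriv E x i"
proof -
  let ?L = "{is. length is = k - 1 \<and> set is \<subseteq> V}"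
  let ?I = "{e. e \<in> E \<and> i \<in> e}"
  let ?f = "\<lambda>is. prod_list (map x is) / fact (k - 1)"
  have finL: "finite ?L"
    using finite_lists_length_eq[OF finite_V, of "k - 1"] by (simp add: conj_commute)
  have L_eq: "{is \<in> ?L. set (i # is) \<in> E} = (\<Union>e\<in>?I. permutations_of_set (e - {i}))"
  proof (intro equalityI subsetI)
    fix "is" assume a: "is \<in> {is \<in> ?L. set (i # is) \<in> E}"
    then have "card (set (i # is)) = length (i # is)"
      using card_edge k_pos by auto
    then have d: "distinct (i # is)"
      by (rule card_distinct)
    show "is \<in> (\<Union>e\<in>?I. permutations_of_set (e - {i}))"
      by (rule UN_I[of "set (i # is)"]) (use a d in \<open>auto simp: permutations_of_set_def\<close>)
  next
    fix "is" assume "is \<in> (\<Union>e\<in>?I. permutations_of_set (e - {i}))"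
    then obtain e where e: "e \<in> E" "i \<in> e" "set is = e - {i}" "distinct is"
      by (auto simp: permutations_of_set_def)
    then have "length is = k - 1"
      using card_edge[OF e(1)] finite_edge[OF e(1)] by (metis card_Diff_singleton distinct_card)
    moreover have "set (i # is) = e"
      using e by auto
    ultimately show "is \<in> {is \<in> ?L. set (i # is) \<in> E}"
      using e edge_subset by auto
  qed
  have "tensor_apply k V (adjacency_tensor k E) x i
      = (\<Sum>is\<in>?L. if set (i # is) \<in> E then ?f is else 0)"
    unfolding tensor_apply_def adjacency_tensor_def by (intro sum.cong refl) simp
  also have "\<dots> = (\<Sum>is | is \<in> ?L \<and> set (i # is) \<in> E. ?f is)"
    using finL by (rule sum.inter_filter[symmetric])
  also have "\<dots> = (\<Sum>is\<in>(\<Union>e\<in>?I. permutations_of_set (e - {i})). ?f is)"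
    by (simp only: L_eq)
  also have "\<dots> = (\<Sum>e\<in>?I. \<Sum>is\<in>permutations_of_set (e - {i}). ?f is)"
  proof (rule sum.UNION_disjoint)
    \<comment> \<open>Both edges contain \<open>i\<close>, so each is recovered from its remaining
      vertices.\<close>
    show "\<forall>e\<in>?I. \<forall>e'\<in>?I. e \<noteq> e' \<longrightarrow>
        permutations_of_set (e - {i}) \<inter> permutations_of_set (e' - {i}) = {}"
      by (auto simp: permutations_of_set_def)
  qed (use finite_E in auto)
  also have "\<dots> = (\<Sum>e\<in>?I. \<Prod>v\<in>e - {i}. x v)"
  proof (rule sum.cong[OF refl])
    fix e assume e: "e \<in> ?I"
    then have c: "card (e - {i}) = k - 1" and fin: "finite (e - {i})"
      using card_edge finite_edge by (auto simp: card_Diff_singleton)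
    have "(\<Sum>is\<in>permutations_of_set (e - {i}). ?f is)
        = (\<Sum>is\<in>permutations_of_set (e - {i}). (\<Prod>v\<in>e - {i}. x v) / fact (k - 1))"
      by (intro sum.cong refl)
        (auto simp: permutations_of_set_def prod.distinct_set_conv_list[symmetric])
    also have "\<dots> = (\<Prod>v\<in>e - {i}. x v)"
      using c fin by simp
    finally show "(\<Sum>is\<in>permutations_of_set (e - {i}). ?f is) = (\<Prod>v\<in>e - {i}. x v)" .
  qed
  finally show ?thesis
    by (simp add: edge_deriv_def)
qed

text \<open>Euler's identity for a form of degree \<open>k\<close>: each edge product is counted
  once at each of its \<open>k\<close> vertices. It turns the eigenvalue equations into one relation
  between \<open>edge_form\<close> and \<open>power_form\<close>.\<close>

lemma sum_edge_deriv:
  fixes x :: "'a \<Rightarrow> 'b::comm_semiring_1"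
  shows "(\<Sum>i\<in>V. x i * edge_deriv E x i) = of_nat k * edge_form E x"
proof -
  have "(\<Sum>i\<in>V. x i * edge_deriv E x i)
      = (\<Sum>i\<in>V. \<Sum>e\<in>E. if i \<in> e then \<Prod>v\<in>e. x v else 0)"
  proof (rule sum.cong[OF refl])
    fix i assume "i \<in> V"
    have "x i * edge_deriv E x i = (\<Sum>e | e \<in> E \<and> i \<in> e. \<Prod>v\<in>e. x v)"
      unfolding edge_deriv_def sum_distrib_left
      by (intro sum.cong refl) (use finite_edge in \<open>auto intro!: prod.remove[symmetric]\<close>)
    then show "x i * edge_deriv E x i = (\<Sum>e\<in>E. if i \<in> e then \<Prod>v\<in>e. x v else 0)"
      by (simp add: sum.inter_filter[OF finite_E])
  qed
  also have "\<dots> = (\<Sum>e\<in>E. \<Sum>i\<in>V. if i \<in> e then \<Prod>v\<in>e. x v else 0)"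
    by (rule sum.swap)
  also have "\<dots> = (\<Sum>e\<in>E. of_nat k * (\<Prod>v\<in>e. x v))"
  proof (rule sum.cong[OF refl])
    fix e assume e: "e \<in> E"
    then have "{i \<in> V. i \<in> e} = e"
      using edge_subset by auto
    then have "(\<Sum>i\<in>V. if i \<in> e then \<Prod>v\<in>e. x v else 0) = (\<Sum>i\<in>e. \<Prod>v\<in>e. x v)"
      by (simp flip: sum.inter_filter[OF finite_V])
    then show "(\<Sum>i\<in>V. if i \<in> e then \<Prod>v\<in>e. x v else 0) = of_nat k * (\<Prod>v\<in>e. x v)"
      using card_edge[OF e] by simp
  qed
  finally show ?thesis
    by (simp add: edge_form_def sum_distrib_left)
qed

section \<open>Scaling, one-coordinate variations and extremal vectors\<close>

lemma edge_form_scale: "edge_form E (\<lambda>v. a * x v) = a ^ k * edge_form E x"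
  unfolding edge_form_def sum_distrib_left
  by (intro sum.cong refl) (simp add: prod.distrib card_edge)

lemma power_form_scale: "power_form k V (\<lambda>v. a * x v) = a ^ k * power_form k V x"
  unfolding power_form_def sum_distrib_left by (simp add: power_mult_distrib)

lemma power_form_pos:
  assumes "i \<in> V" "x i \<noteq> (0::real)"
  shows "0 < power_form k V x"
  unfolding power_form_def
proof (rule sum_pos2[OF finite_V assms(1)])
  show "0 < x i ^ k"
    using assms even_k by (simp add: zero_less_power_eq)
qed (use even_k in \<open>simp add: zero_le_even_power\<close>)

text \<open>A vertex occurs at most once in each edge, so the form is affine in each single
  coordinate and the expansion in \<open>t\<close> is exact.\<close>

lemma edge_form_fun_upd:
  fixes x :: "'a \<Rightarrow> 'b::comm_ring_1"
  shows "edge_form E (x(i := x i + t)) = edge_form E x + t * edge_deriv E x i"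
proof -
  have "edge_form E (x(i := x i + t))
      = (\<Sum>e\<in>E. (\<Prod>v\<in>e. x v) + (if i \<in> e then t * (\<Prod>v\<in>e - {i}. x v) else 0))"
    unfolding edge_form_def
  proof (rule sum.cong[OF refl])
    fix e assume e: "e \<in> E"
    let ?y = "x(i := x i + t)"
    show "(\<Prod>v\<in>e. ?y v) = (\<Prod>v\<in>e. x v) + (if i \<in> e then t * (\<Prod>v\<in>e - {i}. x v) else 0)"
    proof (cases "i \<in> e")
      case True
      have "(\<Prod>v\<in>e - {i}. ?y v) = (\<Prod>v\<in>e - {i}. x v)"
        by (rule prod.cong) auto
      then show ?thesis
        using True prod.remove[OF finite_edge[OF e] True, of ?y]
          prod.remove[OF finite_edge[OF e] True, of x] by (simp add: algebra_simps)
    next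
      case False
      then have "(\<Prod>v\<in>e. ?y v) = (\<Prod>v\<in>e. x v)"
        by (intro prod.cong) auto
      with False show ?thesis by simp
    qed
  qed
  then show ?thesis
    by (simp add: sum.distrib edge_form_def edge_deriv_def sum_distrib_left
        sum.inter_filter[OF finite_E] if_distrib[of "(*) t"] cong: if_cong)
qed

lemma power_form_fun_upd:
  fixes x :: "'a \<Rightarrow> 'b::comm_ring_1"
  assumes "i \<in> V"
  shows "power_form k V (x(i := x i + t)) = power_form k V x - x i ^ k + (x i + t) ^ k"
proof -
  have "(\<Sum>v\<in>V - {i}. (x(i := x i + t)) v ^ k) = (\<Sum>v\<in>V - {i}. x v ^ k)"
    by (rule sum.cong) auto
  then show ?thesis
    unfolding power_form_def
    using sum.remove[OF finite_V assms, of "\<lambda>v. (x(i := x i + t)) v ^ k"]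
      sum.remove[OF finite_V assms, of "\<lambda>v. x v ^ k"] by simp
qed

text \<open>The factor \<open>c\<close> stands for \<open>1\<close> or \<open>-1\<close>, so that maxima and minima are treated alike.\<close>

lemma extremal_vector_exists:
  fixes c :: real
  obtains x :: "'a \<Rightarrow> real" where "power_form k V x = 1"
    and "\<And>y. c * edge_form E y \<le> c * edge_form E x * power_form k V y"
proof -
  \<comment> \<open>Coordinates outside \<open>V\<close> are pinned to 0, which makes the box
    compact in the full function space by Tychonoff's theorem.\<close>
  let ?B = "Pi\<^sub>E UNIV (\<lambda>v. if v \<in> V then {-1..1} else {0}) :: ('a \<Rightarrow> real) set"
  let ?S = "?B \<inter> power_form k V -` {1}"
  have "compactin (product_topology (\<lambda>_. euclidean) UNIV) ?B"
    by (subst compactin_PiE) auto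
  then have "compact ?B"
    by (simp add: euclidean_product_topology)
  moreover have "continuous_on UNIV (power_form k V :: ('a \<Rightarrow> real) \<Rightarrow> real)"
    unfolding power_form_def by (intro continuous_intros continuous_on_product_coordinates)
  then have "closed (power_form k V -` {1::real})"
    by (intro closed_vimage) auto
  ultimately have compact_S: "compact ?S"
    by (rule compact_Int_closed)
  obtain i where i: "i \<in> V"
    using V_nonempty by auto
  have "power_form k V (\<lambda>v. if v = i then 1 else 0 :: real) = 1"
  proof -
    have "power_form k V (\<lambda>v. if v = i then 1 else 0 :: real)
        = (\<Sum>v\<in>V. if v = i then 1 else 0)"
      unfolding power_form_def by (intro sum.cong refl) (use k_pos in auto)
    then show ?thesis
      using i finite_V by simp
  qed
  then have "(\<lambda>v. if v = i then 1 else 0 :: real) \<in> ?S"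
    using i by auto
  then have nonempty_S: "?S \<noteq> {}" by blast
  have "continuous_on ?S (\<lambda>x. c * edge_form E x)"
    unfolding edge_form_def
    by (intro continuous_intros continuous_on_subset[OF continuous_on_product_coordinates]) auto
  from continuous_attains_sup[OF compact_S nonempty_S this]
  obtain x where x: "x \<in> ?S" and max: "\<forall>y\<in>?S. c * edge_form E y \<le> c * edge_form E x" ..
  show thesis
  proof
    show "power_form k V x = 1"
      using x by simp
    fix y :: "'a \<Rightarrow> real"
    show "c * edge_form E y \<le> c * edge_form E x * power_form k V y"
    proof (cases "\<forall>v\<in>V. y v = 0")
      case True
      then have "edge_form E y = edge_form E (\<lambda>v. 0 * y v)"
        by (intro edge_form_cong) auto
      also have "\<dots> = 0"
        unfolding edge_form_scale using k_pos by simp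
      finally have "edge_form E y = 0" .
      moreover have "power_form k V y = 0"
        unfolding power_form_def using True k_pos by (intro sum.neutral) auto
      ultimately show ?thesis by simp
    next
      case False
      then have pos: "0 < power_form k V y"
        using power_form_pos by blast
      \<comment> \<open>Both sides are homogeneous of degree \<open>k\<close> in \<open>y\<close>,
        so \<open>y\<close> may be rescaled to the sphere. Cutting \<open>z\<close> off outside
        \<open>V\<close> puts it into the box.\<close>
      define a where "a = inverse (root k (power_form k V y))"
      have a: "a ^ k * power_form k V y = 1"
        using pos k_pos by (simp add: a_def power_inverse)
      define z where "z = (\<lambda>v. if v \<in> V then a * y v else 0)"
      have Pz: "power_form k V z = 1"
      proof -
        have "power_form k V z = power_form k V (\<lambda>v. a * y v)"
          unfolding power_form_def by (intro sum.cong) (auto simp: z_def)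
        then show ?thesis
          by (simp add: power_form_scale a)
      qed
      have "\<bar>z v\<bar> \<le> 1" if "v \<in> V" for v
      proof -
        have "z v ^ k \<le> power_form k V z"
          unfolding power_form_def using finite_V that even_k
          by (intro member_le_sum) (auto simp: zero_le_even_power)
        then have "\<bar>z v\<bar> ^ k \<le> 1 ^ k"
          using Pz even_k by (simp add: power_even_abs)
        then show ?thesis
          using k_pos by (subst (asm) power_mono_iff) auto
      qed
      then have "z \<in> ?S"
        using Pz by (auto simp: z_def abs_le_iff split: if_splits)
      then have "c * edge_form E z \<le> c * edge_form E x"
        using max by blast
      moreover have "edge_form E z = a ^ k * edge_form E y"
        unfolding edge_form_scale[symmetric] by (intro edge_form_cong) (simp add: z_def)
      ultimately have "c * (a ^ k * edge_form E y) * power_form k V y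
          \<le> c * edge_form E x * power_form k V y"
        using pos by (intro mult_right_mono) auto
      moreover have "c * (a ^ k * edge_form E y) * power_form k V y
          = c * edge_form E y * (a ^ k * power_form k V y)"
        by simp
      ultimately show ?thesis
        by (simp only: a mult_1_right)
    qed
  qed
qed

text \<open>Homogeneity has removed the constraint: the gap between the two sides of
  \<open>ext\<close> is nonnegative for all \<open>y\<close> and vanishes at \<open>y = x\<close>.
  Its partial derivatives at \<open>x\<close> are therefore zero, which replaces Lagrange
  multipliers.\<close>

lemma extremal_vector_eigen:
  fixes c :: real and x :: "'a \<Rightarrow> real"
  assumes "c \<noteq> 0" "power_form k V x = 1"
    and ext: "\<And>y. c * edge_form E y \<le> c * edge_form E x * power_form k V y"
    and i: "i \<in> V"
  shows "edge_deriv E x i = real k * edge_form E x * x i ^ (k - 1)"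
proof -
  let ?r = "edge_form E x"
  \<comment> \<open>The gap when only coordinate \<open>i\<close> moves by \<open>t\<close>; the
    leading 1 in the inner sum is \<open>power_form k V x\<close>.\<close>
  let ?g = "\<lambda>t. c * (?r * (1 - x i ^ k + (x i + t) ^ k) - (?r + t * edge_deriv E x i))"
  have g: "?g t = c * ?r * power_form k V (x(i := x i + t)) - c * edge_form E (x(i := x i + t))" for t
    unfolding power_form_fun_upd[OF i] edge_form_fun_upd assms(2) by (simp add: algebra_simps)
  have "?g 0 \<le> ?g t" for t
    using ext[of "x(i := x i + t)"] g[of t] by simp
  moreover have "(?g has_real_derivative
      c * (?r * (real k * x i ^ (k - 1)) - edge_deriv E x i)) (at 0)"
    by (auto intro!: derivative_eq_intros)
  ultimately have "c * (?r * (real k * x i ^ (k - 1)) - edge_deriv E x i) = 0"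
    by (intro DERIV_local_min[of ?g _ 0 1]) auto
  with assms(1) show ?thesis
    by (simp add: algebra_simps)
qed

section \<open>Extremal values as least H-eigenvalue and spectral radius\<close>

lemma extremal_H_eigenvalue:
  fixes c :: real and x :: "'a \<Rightarrow> real"
  assumes "c \<noteq> 0" "power_form k V x = 1"
    and "\<And>y. c * edge_form E y \<le> c * edge_form E x * power_form k V y"
  shows "H_eigenvalue k V (adjacency_tensor k E) (complex_of_real (real k * edge_form E x))"
proof -
  have "\<exists>i\<in>V. x i \<noteq> 0"
  proof (rule ccontr)
    assume "\<not> ?thesis"
    then have "power_form k V x = 0"
      unfolding power_form_def using k_pos by (intro sum.neutral) auto
    with assms(2) show False by simp
  qed
  moreover have "edge_deriv E (\<lambda>v. complex_of_real (x v)) i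
      = complex_of_real (real k * edge_form E x) * complex_of_real (x i) ^ (k - 1)" if "i \<in> V" for i
  proof -
    have "edge_deriv E (\<lambda>v. complex_of_real (x v)) i = complex_of_real (edge_deriv E x i)"
      by (simp add: edge_deriv_def)
    then show ?thesis
      using extremal_vector_eigen[OF assms that] by simp
  qed
  ultimately show ?thesis
    unfolding H_eigenvalue_def eigenpair_def
    by (intro exI[of _ "\<lambda>v. complex_of_real (x v)"]) (simp add: tensor_apply_adjacency)
qed

text \<open>Pairing the equation of any real eigenvector \<open>y\<close> with \<open>y\<close>
  itself gives, by Euler's identity, k W(y) = r P(y) in the notation of the introduction. Minimality
  of \<open>x\<close> and P(y) > 0 then bound r from below.\<close>

lemma lambda_min_eq:
  assumes "power_form k V x = 1"
    and min: "\<And>y. edge_form E x * power_form k V y \<le> edge_form E y"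
  shows "lambda_min k V E = real k * edge_form E x"
  unfolding lambda_min_def
proof (rule Least_equality)
  show "H_eigenvalue k V (adjacency_tensor k E) (complex_of_real (real k * edge_form E x))"
    by (rule extremal_H_eigenvalue[of "-1"]) (use assms in auto)
next
  fix r assume "H_eigenvalue k V (adjacency_tensor k E) (complex_of_real r)"
  then obtain z where nz: "\<exists>i\<in>V. z i \<noteq> 0" and real: "\<forall>i\<in>V. z i \<in> \<real>"
    and eig: "\<forall>i\<in>V. edge_deriv E z i = complex_of_real r * z i ^ (k - 1)"
    unfolding H_eigenvalue_def eigenpair_def by (auto simp: tensor_apply_adjacency)
  \<comment> \<open>The eigenvector is real on \<open>V\<close> only; its values elsewhere are
    arbitrary.\<close>
  define y where "y = (\<lambda>v. Re (z v))"
  have zy: "z v = complex_of_real (y v)" if "v \<in> V" for v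
    using real that by (simp add: y_def)
  have "edge_deriv E y i = r * y i ^ (k - 1)" if "i \<in> V" for i
  proof -
    have "edge_deriv E z i = edge_deriv E (\<lambda>v. complex_of_real (y v)) i"
      by (rule edge_deriv_cong) (rule zy)
    also have "\<dots> = complex_of_real (edge_deriv E y i)"
      by (simp add: edge_deriv_def)
    finally have "complex_of_real (edge_deriv E y i) = complex_of_real (r * y i ^ (k - 1))"
      using eig that zy by simp
    then show ?thesis
      by (simp only: of_real_eq_iff)
  qed
  then have "(\<Sum>i\<in>V. y i * edge_deriv E y i) = (\<Sum>i\<in>V. r * y i ^ k)"
    by (intro sum.cong refl) (simp add: power_k mult.left_commute)
  then have "real k * edge_form E y = r * power_form k V y"
    by (simp add: sum_edge_deriv power_form_def sum_distrib_left)
  moreover have "real k * (edge_form E x * power_form k V y) \<le> real k * edge_form E y"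
    using min by (intro mult_left_mono) auto
  moreover have "0 < power_form k V y"
    using nz zy power_form_pos by (metis of_real_0)
  ultimately show "real k * edge_form E x \<le> r"
    by (simp add: mult.assoc[symmetric])
qed

text \<open>For a complex eigenvector, passing to moduli turns the eigenvalue equation into an
  inequality by the triangle inequality. Pairing it with the vector of moduli and using maximality
  of \<open>x\<close> bounds the modulus of the eigenvalue.\<close>

lemma spectral_radius_eq:
  assumes "power_form k V x = 1"
    and max: "\<And>y. edge_form E y \<le> edge_form E x * power_form k V y"
  shows "spectral_radius k V E = real k * edge_form E x"
  unfolding spectral_radius_def
proof (rule Greatest_equality)
  \<comment> \<open>The value has to be nonnegative to equal its own modulus; testing maximality on
    the absolute values of \<open>x\<close> shows this.\<close>
  have "0 \<le> edge_form E (\<lambda>v. \<bar>x v\<bar>)"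
    unfolding edge_form_def by (intro sum_nonneg prod_nonneg) auto
  also have "\<dots> \<le> edge_form E x * power_form k V (\<lambda>v. \<bar>x v\<bar>)"
    by (rule max)
  also have "power_form k V (\<lambda>v. \<bar>x v\<bar>) = 1"
    using assms(1) even_k by (simp add: power_form_def power_even_abs)
  finally have "0 \<le> edge_form E x" by simp
  moreover have "eigenvalue k V (adjacency_tensor k E) (complex_of_real (real k * edge_form E x))"
    using extremal_H_eigenvalue[of 1 x] assms
    by (auto simp: H_eigenvalue_def eigenvalue_def)
  ultimately show "\<exists>\<mu>. eigenvalue k V (adjacency_tensor k E) \<mu> \<and> real k * edge_form E x = cmod \<mu>"
    by (intro exI[of _ "complex_of_real (real k * edge_form E x)"]) (simp add: norm_mult)
next
  fix r assume "\<exists>\<mu>. eigenvalue k V (adjacency_tensor k E) \<mu> \<and> r = cmod \<mu>"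
  then obtain \<mu> z where r: "r = cmod \<mu>" and nz: "\<exists>i\<in>V. z i \<noteq> 0"
    and eig: "\<forall>i\<in>V. edge_deriv E z i = \<mu> * z i ^ (k - 1)"
    unfolding eigenvalue_def eigenpair_def by (auto simp: tensor_apply_adjacency)
  define y where "y = (\<lambda>v. cmod (z v))"
  have "r * y i ^ (k - 1) \<le> edge_deriv E y i" if "i \<in> V" for i
  proof -
    have "r * y i ^ (k - 1) = cmod (edge_deriv E z i)"
      using eig that by (simp add: r y_def norm_mult norm_power)
    also have "\<dots> \<le> edge_deriv E y i"
      unfolding edge_deriv_def y_def by (rule order.trans[OF norm_sum]) (simp add: prod_norm)
    finally show ?thesis .
  qed
  then have "(\<Sum>i\<in>V. y i * (r * y i ^ (k - 1))) \<le> (\<Sum>i\<in>V. y i * edge_deriv E y i)"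
    by (intro sum_mono mult_left_mono) (auto simp: y_def)
  moreover have "(\<Sum>i\<in>V. y i * (r * y i ^ (k - 1))) = r * power_form k V y"
    unfolding power_form_def sum_distrib_left
    by (intro sum.cong refl) (simp add: power_k mult.left_commute)
  ultimately have "r * power_form k V y \<le> real k * edge_form E y"
    by (simp add: sum_edge_deriv)
  also have "\<dots> \<le> real k * (edge_form E x * power_form k V y)"
    using max by (intro mult_left_mono) auto
  finally have "r * power_form k V y \<le> real k * edge_form E x * power_form k V y"
    by (simp add: mult.assoc)
  moreover have "0 < power_form k V y"
    using nz by (auto simp: y_def intro: power_form_pos)
  ultimately show "r \<le> real k * edge_form E x"
    by simp
qed

section \<open>Test vectors, a nonnegative maximizer and edge deletion\<close>

lemma lambda_min_le:
  assumes "power_form k V y = 1"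
  shows "lambda_min k V E \<le> real k * edge_form E y"
proof -
  obtain x where x: "power_form k V x = (1::real)"
    and "\<And>y. - 1 * edge_form E y \<le> - 1 * edge_form E x * power_form k V y"
    using extremal_vector_exists[of "- 1"] by blast
  then have min: "edge_form E x * power_form k V y \<le> edge_form E y" for y
    by simp
  show ?thesis
    using lambda_min_eq[OF x min] min[of y] assms by (simp add: mult_left_mono)
qed

lemma spectral_radius_attained:
  obtains x where "power_form k V x = 1" "\<And>v. 0 \<le> x v"
    "spectral_radius k V E = real k * edge_form E x"
proof -
  obtain x where x: "power_form k V x = (1::real)"
    and "\<And>y. 1 * edge_form E y \<le> 1 * edge_form E x * power_form k V y"
    using extremal_vector_exists[of 1] by blast
  then have max: "edge_form E y \<le> edge_form E x * power_form k V y" for y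
    by simp
  let ?u = "\<lambda>v. \<bar>x v\<bar>"
  have u: "power_form k V ?u = 1"
    using x even_k by (simp add: power_form_def power_even_abs)
  \<comment> \<open>Absolute values keep the power sum, as \<open>k\<close> is even, and cannot
    lower the form, so they give another maximizer.\<close>
  have "edge_form E x \<le> edge_form E ?u"
    unfolding edge_form_def by (intro sum_mono) (metis abs_ge_self abs_prod)
  then have "edge_form E ?u = edge_form E x"
    using max[of ?u] u by simp
  then show thesis
    using that[of ?u] u spectral_radius_eq[OF x max] by simp
qed

text \<open>The sign-switched vector serves as test vector in \<open>lambda_min_le\<close>. The
  factor 2 arises because the product over \<open>e\<close> is first removed from the negated total
  and then added back as a bound for its own contribution.\<close>

lemma lambda_min_le_delete_edge:
  assumes x: "power_form k V x = 1" "\<And>v. 0 \<le> x v"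
    and e: "e \<in> E" and bip: "odd_bipartite V (E - {e})"
  shows "lambda_min k V E \<le> - (real k * edge_form E x) + 2 * real k * (\<Prod>v\<in>e. x v)"
proof -
  obtain U where U: "\<forall>f\<in>E - {e}. odd (card (f \<inter> U))"
    using bip by (auto simp: odd_bipartite_def)
  define s where "s v = (if v \<in> U then - 1 else 1 :: real)" for v
  define y where "y v = s v * x v" for v
  have s_prod: "(\<Prod>v\<in>f. s v) = (- 1) ^ card (f \<inter> U)" if "f \<in> E" for f
    unfolding s_def using finite_edge[OF that] by (simp add: prod.If_cases Int_def)
  have y_prod: "(\<Prod>v\<in>f. y v) = (- 1) ^ card (f \<inter> U) * (\<Prod>v\<in>f. x v)" if "f \<in> E" for f
    unfolding y_def prod.distrib s_prod[OF that] ..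
  have "y v ^ k = x v ^ k" for v
    using even_k by (simp add: y_def s_def)
  then have "power_form k V y = 1"
    using x(1) by (simp add: power_form_def)
  then have "lambda_min k V E \<le> real k * edge_form E y"
    by (rule lambda_min_le)
  moreover have "edge_form E y \<le> - edge_form E x + 2 * (\<Prod>v\<in>e. x v)"
  proof -
    have "(\<Sum>f\<in>E - {e}. \<Prod>v\<in>f. y v) = - (\<Sum>f\<in>E - {e}. \<Prod>v\<in>f. x v)"
      unfolding sum_negf[symmetric] using U by (intro sum.cong refl) (simp add: y_prod)
    \<comment> \<open>The hypothesis does not fix the parity of \<open>e\<close> on
      \<open>U\<close>; either sign gives the bound since \<open>x\<close> is nonnegative.\<close>
    moreover have "(\<Prod>v\<in>e. y v) \<le> (\<Prod>v\<in>e. x v)"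
      using x(2) prod_nonneg[of e x] by (cases "even (card (e \<inter> U))") (simp_all add: y_prod[OF e])
    ultimately show ?thesis
      unfolding edge_form_def
      using sum.remove[OF finite_E e, of "\<lambda>f. \<Prod>v\<in>f. x v"]
        sum.remove[OF finite_E e, of "\<lambda>f. \<Prod>v\<in>f. y v"] by simp
  qed
  then have "real k * edge_form E y \<le> real k * (- edge_form E x + 2 * (\<Prod>v\<in>e. x v))"
    by (rule mult_left_mono) simp
  ultimately show ?thesis
    by (simp add: algebra_simps)
qed

text \<open>The \<open>k\<close>-th powers of the entries sum to 1, so one of them is at most the
  average.\<close>

lemma exists_small_entry:
  assumes x: "power_form k V x = 1" "\<And>v. 0 \<le> x v"
  obtains v where "v \<in> V" "x v \<le> 1 / root k (real (card V))"
proof -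
  have n: "0 < card V"
    using V_nonempty finite_V by (simp add: card_gt_0_iff)
  have "\<exists>v\<in>V. x v ^ k \<le> 1 / real (card V)"
  proof (rule ccontr)
    assume "\<not> ?thesis"
    then have "(\<Sum>v\<in>V. 1 / real (card V)) < (\<Sum>v\<in>V. x v ^ k)"
      using finite_V V_nonempty by (intro sum_strict_mono) auto
    with x(1) n show False
      by (simp add: power_form_def)
  qed
  then obtain v where v: "v \<in> V" "x v ^ k \<le> 1 / real (card V)" ..
  have "x v = root k (x v ^ k)"
    using k_pos x(2) by (simp add: real_root_power_cancel)
  also have "\<dots> \<le> root k (1 / real (card V))"
    using k_pos v(2) by simp
  finally show thesis
    using that[OF v(1)] k_pos by (simp add: real_root_divide)
qed

text \<open>Every entry lies between 0 and 1 on the sphere, so the remaining factors can only shrink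
  the product.\<close>

lemma edge_product_le_entry:
  fixes x :: "'a \<Rightarrow> real"
  assumes x: "power_form k V x = 1" "\<And>v. 0 \<le> x v"
    and e: "e \<in> E" "v \<in> e"
  shows "(\<Prod>u\<in>e. x u) \<le> x v"
proof -
  have "x u \<le> 1" if "u \<in> e" for u
  proof -
    have "x u ^ k \<le> power_form k V x"
      unfolding power_form_def using finite_V that x(2) edge_subset[OF e(1)]
      by (intro member_le_sum) auto
    then have "x u ^ k \<le> 1 ^ k"
      using x(1) by simp
    then show ?thesis
      using k_pos x(2) by (subst (asm) power_mono_iff) auto
  qed
  then have "(\<Prod>u\<in>e - {v}. x u) \<le> 1"
    using x(2) by (intro prod_le_1) auto
  then have "x v * (\<Prod>u\<in>e - {v}. x u) \<le> x v"
    using x(2) by (simp add: mult_left_le)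
  then show ?thesis
    using prod.remove[OF finite_edge[OF e(1)] e(2), of x] by simp
qed

end

section \<open>Choice of the deleted edge for each bound\<close>

theorem theorem5p1:
  fixes V :: "'a set" and E :: "'a set set" and k n m :: nat
  assumes "even k"
    and "hypergraph V E"
    and "uniform_hypergraph k E"
    and "minimal_non_odd_bipartite V E"
    and "card V = n"
    and "card E = m"
  shows "lambda_min k V E \<le> - spectral_radius k V E + 2 * real k / root k (real n) \<and>
         lambda_min k V E \<le> - (1 - 2 / real m) * spectral_radius k V E"
proof -
  \<comment> \<open>Without edges, odd-bipartiteness would hold vacuously.\<close>
  have E_ne: "E \<noteq> {}"
    using assms(4) by (auto simp: minimal_non_odd_bipartite_def odd_bipartite_def)
  have bip: "odd_bipartite V (E - {e})" if "e \<in> E" for e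
    using assms(4) that by (simp add: minimal_non_odd_bipartite_def)
  have hyp: "finite V" "\<And>e. e \<in> E \<Longrightarrow> e \<subseteq> V \<and> e \<noteq> {}" "\<And>v. v \<in> V \<Longrightarrow> \<exists>e\<in>E. v \<in> e"
    using assms(2) by (auto simp: hypergraph_def)
  have card: "card e = k" if "e \<in> E" for e
    using assms(3) that by (simp add: uniform_hypergraph_def)
  obtain e\<^sub>0 where e\<^sub>0: "e\<^sub>0 \<in> E"
    using E_ne by blast
  then have "0 < card e\<^sub>0"
    using hyp(1) hyp(2)[OF e\<^sub>0] by (auto simp: card_gt_0_iff intro: finite_subset)
  then have "0 < k"
    using card[OF e\<^sub>0] by simp
  then interpret even_uniform_hypergraph k V E
    using assms(1) hyp card e\<^sub>0 by unfold_locales blast+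
  obtain x where x: "power_form k V x = 1" "\<And>v. 0 \<le> x v"
    and rho: "spectral_radius k V E = real k * edge_form E x"
    using spectral_radius_attained by blast
  have "lambda_min k V E \<le> - spectral_radius k V E + 2 * real k / root k (real n)"
  proof -
    obtain v where v: "v \<in> V" "x v \<le> 1 / root k (real (card V))"
      using exists_small_entry[OF x] .
    obtain e where e: "e \<in> E" "v \<in> e"
      using hyp(3)[OF v(1)] by blast
    have "(\<Prod>u\<in>e. x u) \<le> 1 / root k (real n)"
      using edge_product_le_entry[OF x e] v(2) assms(5) by simp
    then have "2 * real k * (\<Prod>u\<in>e. x u) \<le> 2 * real k * (1 / root k (real n))"
      by (intro mult_left_mono) auto
    then show ?thesis
      using lambda_min_le_delete_edge[OF x e(1) bip[OF e(1)]] rho by simp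
  qed
  moreover have "lambda_min k V E \<le> - (1 - 2 / real m) * spectral_radius k V E"
  proof -
    have m: "0 < m"
      using assms(6) finite_E E_ne by (auto simp: card_gt_0_iff)
    \<comment> \<open>The \<open>m\<close> edge products sum to \<open>edge_form E x\<close>, so
      some edge is at most average. Multiplied by 2k, this average is 2/m times the spectral
      radius.\<close>
    have "\<exists>e\<in>E. (\<Prod>u\<in>e. x u) \<le> edge_form E x / real m"
    proof (rule ccontr)
      assume "\<not> ?thesis"
      then have "(\<Sum>e\<in>E. edge_form E x / real m) < edge_form E x"
        unfolding edge_form_def[of E x] using finite_E E_ne by (intro sum_strict_mono) auto
      with m show False
        by (simp add: assms(6))
    qed
    then obtain e where e: "e \<in> E" "(\<Prod>u\<in>e. x u) \<le> edge_form E x / real m" ..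
    then have "2 * real k * (\<Prod>u\<in>e. x u) \<le> 2 * real k * (edge_form E x / real m)"
      by (intro mult_left_mono) auto
    then show ?thesis
      using lambda_min_le_delete_edge[OF x e(1) bip[OF e(1)]] rho by (simp add: algebra_simps)
  qed
  ultimately show ?thesis ..
qed

end
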